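(* For every positive integer $d$ there exists $n$ with the following property: for every linear ordering $\prec$ of $[2]^n$ there is a $d$-subcube $C$ of $[2]^n$ such that the restriction of $\prec$ to $C$ (viewed, via the canonical bijection, as a linear ordering of $[2]^d$) is the lexicographic ordering on $[2]^d$ induced by one of the two linear orderings of $[2]$.
   Context: Elements of $[k]^n$ ($[k]=\{1,\dotsc,k\}$) are words of length $n$ over the alphabet $[k]$. A $d$-parameter word of length $n$ is a word $p$ of length $n$ over the alphabet $[k]\cup\{*_1,\dotsc,*_d\}$ containing each of $*_1,\dotsc,*_d$ at least once. For a word $w=w_1\dotsb w_d$, $p[w]$ denotes the word obtained from $p$ by replacing every occurrence of $*_i$ by $w_i$ for each $i$. The set $\{p[w]: w\in[k]^d\}$ is called a $d$-subcube of $[k]^n$. A $d$-parameter word is canonical if the first occurrence of $*_1$ precedes the first occurrence of $*_2$, which precedes the first occurrence of $*_3$, etc. Every $d$-subcube is induced by a unique canonical word $p$, and $w\mapsto p[w]$ is the canonical bijection between $[k]^d$ and the subcube. The restriction of a linear ordering $\prec$ of $[k]^n$ to the subcube is the linear ordering of $[k]^d$ given by $w\prec w'$ iff $p[w]\prec p[w']$. Given a linear ordering $<$ of $[k]$, the lexicographic ordering $<_{\mathrm{lex}}$ on $[k]^d$ is defined by $w<_{\mathrm{lex}}w'$ iff $w_i<w'_i$ where $i$ is the least index with $w_i\ne w'_i$. *)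

theory Defs
  imports Main
begin

definition words :: "nat \<Rightarrow> nat \<Rightarrow> nat list set" where
  "words k n = {w. length w = n \<and> set w \<subseteq> {1..k}}"

(* Parameters are numbered from 0, in line with list indexing: Star i is the parameter *_(i+1). *)
datatype symbol = Letter nat | Star nat

definition param_word :: "nat \<Rightarrow> nat \<Rightarrow> nat \<Rightarrow> symbol list \<Rightarrow> bool" where
  "param_word k d n p \<longleftrightarrow>
     length p = n \<and>
     set p \<subseteq> Letter ` {1..k} \<union> Star ` {..<d} \<and>
     (\<forall>i<d. Star i \<in> set p)"

fun subst_symbol :: "nat list \<Rightarrow> symbol \<Rightarrow> nat" where
  "subst_symbol w (Letter a) = a"
| "subst_symbol w (Star i) = w ! i"

definition subst_word :: "symbol list \<Rightarrow> nat list \<Rightarrow> nat list" where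
  "subst_word p w = map (subst_symbol w) p"

definition cube_of :: "nat \<Rightarrow> nat \<Rightarrow> symbol list \<Rightarrow> nat list set" where
  "cube_of k d p = subst_word p ` words k d"

definition is_subcube :: "nat \<Rightarrow> nat \<Rightarrow> nat \<Rightarrow> nat list set \<Rightarrow> bool" where
  "is_subcube k d n C \<longleftrightarrow> (\<exists>p. param_word k d n p \<and> C = cube_of k d p)"

definition first_occ :: "symbol \<Rightarrow> symbol list \<Rightarrow> nat" where
  "first_occ x p = (LEAST i. i < length p \<and> p ! i = x)"

definition canonical :: "nat \<Rightarrow> symbol list \<Rightarrow> bool" where
  "canonical d p \<longleftrightarrow> (\<forall>i j. i < j \<and> j < d \<longrightarrow> first_occ (Star i) p < first_occ (Star j) p)"

(* Linear orderings are strict; strict_linear_order_on alone does not confine r to A. *)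
definition linear_ordering :: "'a set \<Rightarrow> ('a \<times> 'a) set \<Rightarrow> bool" where
  "linear_ordering A r \<longleftrightarrow> r \<subseteq> A \<times> A \<and> strict_linear_order_on A r"

(* For a canonical p this is the restriction of r to the subcube induced by p. *)
definition restriction :: "nat \<Rightarrow> nat \<Rightarrow> symbol list \<Rightarrow> (nat list \<times> nat list) set \<Rightarrow>
    (nat list \<times> nat list) set" where
  "restriction k d p r =
     {(w, w'). w \<in> words k d \<and> w' \<in> words k d \<and> (subst_word p w, subst_word p w') \<in> r}"

(* lexn compares lists of length d over the whole type nat, hence the intersection. *)
definition lex_ordering :: "nat \<Rightarrow> nat \<Rightarrow> (nat \<times> nat) set \<Rightarrow> (nat list \<times> nat list) set" where
  "lex_ordering k d lt = lexn lt d \<inter> words k d \<times> words k d"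

end

theory Submission
  imports Defs "HOL-Library.Ramsey"
begin

text \<open>Identify words over \<open>{1, 2}\<close> with subsets of \<open>{..<n}\<close>. Fix points
  \<open>g 0 < g 1 < \<dots>\<close> in \<open>{..<n}\<close>, grouped into \<open>t = 4 * d\<close> cells of five, and let a vector \<open>c\<close>
  with entries at most 2 stand for the union of the intervals \<open>{g (5 * k + c k)..<g (5 * k + 4)}\<close>.
  By Ramsey's theorem \<open>g\<close> can be chosen so that the comparison of two such sets depends only on
  which coordinates grow and which shrink. Transitivity then makes the cells linearly ordered by
  significance: the most significant cell in which two vectors differ decides, provided growing is
  always an improvement, which holds (or fails) on half of the cells. On these \<open>2 * d\<close> cells, let
  the first star occupy the leftmost and the most significant cell, discard both and repeat: stars
  then appear in order of decreasing significance. Stars have to live in two separate cells since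
  the significance of a cell need not be related to its position.\<close>

section \<open>Ramsey's theorem for increasing lists\<close>

text \<open>\<open>ramsey_full\<close> colours with numbers below the length of a list; the
  numbering \<open>e\<close> carries it over to an arbitrary finite set of colours.\<close>

lemma ramsey_finite_colours:
  fixes C :: "'c set"
  assumes "finite C"
  shows "\<exists>N::nat. \<forall>f. f \<in> nsets {..<N} r \<rightarrow> C \<longrightarrow>
           (\<exists>H \<in> nsets {..<N} q. \<exists>c. \<forall>S \<in> nsets H r. f S = c)"
proof -
  obtain e :: "'c \<Rightarrow> nat" where e: "bij_betw e C {..<card C}"
    using assms by (metis ex_bij_betw_finite_nat atLeast0LessThan)
  obtain N where N: "partn_lst {..<N::nat} (replicate (card C) q) r"
    using ramsey_full by blast
  have "\<exists>H \<in> nsets {..<N} q. \<exists>c. \<forall>S \<in> nsets H r. f S = c"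
    if f: "f \<in> nsets {..<N} r \<rightarrow> C" for f
  proof -
    have "(\<lambda>S. e (f S)) \<in> nsets {..<N} r \<rightarrow> {..<card C}"
      using f e unfolding bij_betw_def by blast
    then obtain i H where H: "i < card C" "H \<in> nsets {..<N} q"
        "(\<lambda>S. e (f S)) ` nsets H r \<subseteq> {i}"
      by (rule partn_lstE[OF N]) auto
    have "f S = inv_into C e i" if S: "S \<in> nsets H r" for S
    proof -
      have "S \<in> nsets {..<N} r"
        using S H(2) nsets_mono[of H "{..<N}" r] by (auto simp: nsets_def)
      then have "f S \<in> C" using f by auto
      moreover have "e (f S) = i" using H(3) S by auto
      ultimately show ?thesis using e by (metis bij_betw_inv_into_left)
    qed
    then show ?thesis using H(2) by blast
  qed
  then show ?thesis by blast
qed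

text \<open>Subsets of size \<open>r\<close> and strictly increasing lists of length
  \<open>r\<close> are the same thing: \<open>g\<close> enumerates the homogeneous set and
  \<open>h\<close> picks \<open>r\<close> of its elements. In this form \<open>h\<close> can
  prescribe which points take part in a comparison.\<close>

lemma ramsey_increasing_lists:
  fixes C :: "'c set" and q r :: nat
  assumes "finite C"
  shows "\<exists>N::nat. \<forall>f. (\<forall>xs. f xs \<in> C) \<longrightarrow>
           (\<exists>g c. strict_mono_on {..<q} g \<and> g ` {..<q} \<subseteq> {..<N} \<and>
             (\<forall>h. strict_mono_on {..<r} h \<and> h ` {..<r} \<subseteq> {..<q} \<longrightarrow>
                f (map (g \<circ> h) [0..<r]) = c))"
proof -
  obtain N where N: "\<And>f. f \<in> nsets {..<N::nat} r \<rightarrow> C \<Longrightarrow>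
      (\<exists>H \<in> nsets {..<N} q. \<exists>c. \<forall>S \<in> nsets H r. f S = c)"
    using ramsey_finite_colours[OF assms] by metis
  have "\<exists>g c. strict_mono_on {..<q} g \<and> g ` {..<q} \<subseteq> {..<N} \<and>
      (\<forall>h. strict_mono_on {..<r} h \<and> h ` {..<r} \<subseteq> {..<q} \<longrightarrow> f (map (g \<circ> h) [0..<r]) = c)"
    if "\<forall>xs. f xs \<in> C" for f
  proof -
    have "(\<lambda>S. f (sorted_list_of_set S)) \<in> nsets {..<N} r \<rightarrow> C" using that by blast
    from N[OF this] obtain H c where H: "H \<in> nsets {..<N} q"
        and c: "\<And>S. S \<in> nsets H r \<Longrightarrow> f (sorted_list_of_set S) = c"
      by blast
    have fin: "finite H" "card H = q" "H \<subseteq> {..<N}" using H by (auto simp: nsets_def)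
    define g where "g i = sorted_list_of_set H ! i" for i
    have g: "strict_mono_on {..<q} g"
      using fin strict_sorted_list_of_set[of H]
      by (auto simp: strict_mono_on_def g_def sorted_wrt_iff_nth_less)
    have gH: "g ` {..<q} \<subseteq> H"
      using fin nth_mem[of _ "sorted_list_of_set H"] by (auto simp: g_def)
    have "f (map (g \<circ> h) [0..<r]) = c"
      if h: "strict_mono_on {..<r} h" "h ` {..<r} \<subseteq> {..<q}" for h
    proof -
      have gh: "strict_mono_on {..<r} (g \<circ> h)"
        using g h unfolding strict_mono_on_def by (auto simp: image_subset_iff)
      have "sorted_wrt (<) (map (g \<circ> h) [0..<r])"
        using gh by (auto simp: sorted_wrt_iff_nth_less strict_mono_on_def)
      then have "sorted_list_of_set (set (map (g \<circ> h) [0..<r])) = map (g \<circ> h) [0..<r]"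
        by (metis sorted_list_of_set.idem_if_sorted_distinct strict_sorted_iff)
      moreover have "set (map (g \<circ> h) [0..<r]) \<in> nsets H r"
      proof -
        have "inj_on (g \<circ> h) {..<r}" by (rule strict_mono_on_imp_inj_on[OF gh])
        then have "card ((g \<circ> h) ` {..<r}) = r" by (simp only: card_image card_lessThan)
        moreover have "(g \<circ> h) ` {..<r} \<subseteq> H" using gH h(2) by auto
        ultimately show ?thesis by (simp add: nsets_def atLeast0LessThan)
      qed
      ultimately show ?thesis using c[of "set (map (g \<circ> h) [0..<r])"] by (simp only:)
    qed
    moreover have "g ` {..<q} \<subseteq> {..<N}" using gH fin(3) by (rule subset_trans)
    ultimately show ?thesis using g by (intro exI[of _ g] exI[of _ c]) simp
  qed
  then show ?thesis by (intro exI[of _ N]) simp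
qed

section \<open>Homogeneous families of sets\<close>

text \<open>For entries at most 2, the offsets 0, 1, 2 of a cell are starting points, 3 is kept
  spare and 4 is the end. A smaller \<open>c k\<close> gives a longer interval, so a cell grows when
  its entry in \<open>c\<close> drops.\<close>

definition tails :: "nat \<Rightarrow> (nat \<Rightarrow> nat) \<Rightarrow> (nat \<Rightarrow> nat) \<Rightarrow> nat set" where
  "tails t g c = (\<Union>k<t. {g (5 * k + c k)..<g (5 * k + 4)})"

lemma tails_subset:
  assumes "g ` {..<5 * t} \<subseteq> {..<n}"
  shows "tails t g c \<subseteq> {..<n}"
proof -
  have "g (5 * k + 4) < n" if "k < t" for k
    using assms that by (auto simp: image_subset_iff)
  then show ?thesis unfolding tails_def by (auto intro: less_trans)
qed

text \<open>The starting point of cell \<open>k\<close> in the first set separates the two sets: in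
  the second set cell \<open>k\<close> starts later, and all other cells lie entirely to its left or
  right.\<close>

lemma tails_neq:
  assumes g: "strict_mono_on {..<5 * t} g" and k: "k < t" "c k < c' k" and c: "\<And>k. c' k \<le> 2"
  shows "tails t g c \<noteq> tails t g c'"
proof -
  have lt: "g i < g j" if "i < j" "j < 5 * t" for i j
    using g that unfolding strict_mono_on_def by auto
  let ?q = "g (5 * k + c k)"
  have "?q \<in> tails t g c"
    using k c[of k] lt[of "5 * k + c k" "5 * k + 4"] unfolding tails_def by auto
  moreover have "?q \<notin> tails t g c'"
  proof
    assume "?q \<in> tails t g c'"
    then obtain l where l: "l < t" "g (5 * l + c' l) \<le> ?q" "?q < g (5 * l + 4)"
      unfolding tails_def by auto
    consider "l < k" | "l = k" | "k < l" by linarith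
    then show False
    proof cases
      case 1
      then show ?thesis using l lt[of "5 * l + 4" "5 * k + c k"] k c[of k] by simp
    next
      case 2
      then show ?thesis using l lt[of "5 * k + c k" "5 * k + c' k"] k c[of k] by simp
    next
      case 3
      then show ?thesis using l lt[of "5 * k + c k" "5 * l + c' l"] k c[of k] c[of l] by simp
    qed
  qed
  ultimately show ?thesis by blast
qed

text \<open>Two families of tails are compared through the increasing list of one or two starting points
  and the end point of each cell; the spare point \<open>5 * k + 3\<close> fills up the list when the starting
  points of cell \<open>k\<close> agree.\<close>

lemma homogeneous_tails:
  "\<exists>n. \<forall>r :: (nat set \<times> nat set) set. \<exists>g Q. strict_mono_on {..<5 * t} g \<and> g ` {..<5 * t} \<subseteq> {..<n} \<and>
     (\<forall>c c'. (\<forall>k. c k \<le> 2) \<and> (\<forall>k. c' k \<le> 2) \<longrightarrow>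
        ((tails t g c, tails t g c') \<in> r \<longleftrightarrow> Q {k. k < t \<and> c' k < c k} {k. k < t \<and> c k < c' k}))"
proof -
  \<comment> \<open>A list with three entries per cell carries two candidate starting points and the
    end; \<open>X\<close> selects the cells that use the earlier start. So one list encodes both
    sets of a comparison.\<close>
  define V where "V xs X = (\<Union>k<t. {xs ! (3 * k + (if k \<in> X then 0 else 1))..<xs ! (3 * k + 2)})"
    for xs :: "nat list" and X
  have "finite (Pow (Pow {..<t} \<times> Pow {..<t}))" by simp
  from ramsey_increasing_lists[OF this, where q = "5 * t" and r = "3 * t"]
  obtain n :: nat where n: "\<forall>f. (\<forall>xs. f xs \<in> Pow (Pow {..<t} \<times> Pow {..<t})) \<longrightarrow>
      (\<exists>g c. strict_mono_on {..<5 * t} g \<and> g ` {..<5 * t} \<subseteq> {..<n} \<and>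
        (\<forall>h. strict_mono_on {..<3 * t} h \<and> h ` {..<3 * t} \<subseteq> {..<5 * t} \<longrightarrow>
           f (map (g \<circ> h) [0..<3 * t]) = c))"
    ..
  have "\<exists>g Q. strict_mono_on {..<5 * t} g \<and> g ` {..<5 * t} \<subseteq> {..<n} \<and>
     (\<forall>c c'. (\<forall>k. c k \<le> 2) \<and> (\<forall>k. c' k \<le> 2) \<longrightarrow>
        ((tails t g c, tails t g c') \<in> r \<longleftrightarrow> Q {k. k < t \<and> c' k < c k} {k. k < t \<and> c k < c' k}))"
    for r :: "(nat set \<times> nat set) set"
  proof -
    \<comment> \<open>The colour of a list records the outcome of every comparison between two sets
      decoded from it. There are finitely many colours, and a constant colour fixes all outcomes at
      once.\<close>
    define f where "f xs = {(X, Y). X \<subseteq> {..<t} \<and> Y \<subseteq> {..<t} \<and> (V xs X, V xs Y) \<in> r}" for xs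
    have "\<forall>xs. f xs \<in> Pow (Pow {..<t} \<times> Pow {..<t})" by (auto simp: f_def)
    from n[THEN spec, THEN mp, OF this]
    obtain g K where g: "strict_mono_on {..<5 * t} g" "g ` {..<5 * t} \<subseteq> {..<n}"
      and K: "\<And>h. strict_mono_on {..<3 * t} h \<Longrightarrow> h ` {..<3 * t} \<subseteq> {..<5 * t} \<Longrightarrow>
                f (map (g \<circ> h) [0..<3 * t]) = K"
      by auto
    \<comment> \<open>Where \<open>c' k < c k\<close>, the vector \<open>c\<close> uses the later of
      the two starting points; on all other cells it uses the first list entry. Hence the
      complements.\<close>
    define Q where "Q U D \<longleftrightarrow> ({..<t} - U, {..<t} - D) \<in> K" for U D
    have "(tails t g c, tails t g c') \<in> r \<longleftrightarrow>
            Q {k. k < t \<and> c' k < c k} {k. k < t \<and> c k < c' k}"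
      if c: "\<And>k. c k \<le> 2" "\<And>k. c' k \<le> 2" for c c'
    proof -
      define off where "off k m = (if m = 0 then min (c k) (c' k)
          else if m = 1 then (if c k = c' k then 3 else max (c k) (c' k)) else 4)" for k m :: nat
      define h where "h i = 5 * (i div 3) + off (i div 3) (i mod 3)" for i
      have off4: "off k m \<le> 4" for k m
        using c[of k] by (auto simp: off_def)
      have off_mono: "off k m < off k m'" if "m < m'" "m' < 3" for k m m'
        using c[of k] that by (auto simp: off_def)
      have h: "strict_mono_on {..<3 * t} h"
      proof (rule strict_mono_onI)
        fix i j :: nat assume "i < j"
        then consider "i div 3 < j div 3" | "i div 3 = j div 3" "i mod 3 < j mod 3"
          by (metis div_le_mono div_mult_mod_eq le_neq_implies_less less_imp_le nat_add_left_cancel_less)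
        then show "h i < h j"
        proof cases
          case 1
          then show ?thesis using off4[of "i div 3" "i mod 3"] by (simp add: h_def)
        next
          case 2
          then show ?thesis using off_mono[of "i mod 3" "j mod 3"] by (simp add: h_def)
        qed
      qed
      have h_in: "h ` {..<3 * t} \<subseteq> {..<5 * t}"
      proof -
        have "h i < 5 * t" if "i < 3 * t" for i
        proof -
          have "i div 3 < t" using that by (simp add: less_mult_imp_div_less mult.commute)
          then show ?thesis using off4[of "i div 3" "i mod 3"] by (simp add: h_def)
        qed
        then show ?thesis by auto
      qed
      let ?xs = "map (g \<circ> h) [0..<3 * t]"
      have nth: "?xs ! (3 * k + m) = g (5 * k + off k m)" if "k < t" "m < 3" for k m
        using that by (simp add: h_def)
      \<comment> \<open>The roles of \<open>c\<close> and \<open>c'\<close> are symmetric, so both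
        are decoded by one argument. Where they agree, both use the first entry of the cell and the
        spare point is never read.\<close>
      have V: "V ?xs ({..<t} - {k. k < t \<and> b k < a k}) = tails t g a"
        if ab: "(a = c \<and> b = c') \<or> (a = c' \<and> b = c)" for a b
        unfolding V_def tails_def
      proof (rule SUP_cong[OF refl])
        fix k assume "k \<in> {..<t}"
        then have k: "k < t" by simp
        have "off k (if k \<in> {..<t} - {k. k < t \<and> b k < a k} then 0 else 1) = a k"
          using k ab by (auto simp: off_def)
        then have "?xs ! (3 * k + (if k \<in> {..<t} - {k. k < t \<and> b k < a k} then 0 else 1))
            = g (5 * k + a k)"
          using nth[OF k, of "if k \<in> {..<t} - {k. k < t \<and> b k < a k} then 0 else 1"] by simp
        moreover have "?xs ! (3 * k + 2) = g (5 * k + 4)"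
          using nth[OF k, of 2] by (simp add: off_def)
        ultimately show "{?xs ! (3 * k + (if k \<in> {..<t} - {k. k < t \<and> b k < a k} then 0 else 1))
            ..<?xs ! (3 * k + 2)} = {g (5 * k + a k)..<g (5 * k + 4)}"
          by simp
      qed
      show ?thesis
        unfolding Q_def K[OF h h_in, symmetric] f_def using V[of c c'] V[of c' c] by auto
    qed
    then show ?thesis using g by blast
  qed
  then show ?thesis by blast
qed


section \<open>Lexicographic blocks\<close>

text \<open>Used with two relations: \<open><\<close> on positions, for canonicity of the parameter
  word, and significance of cells, for the lexicographic order. The leader \<open>a\<close> of
  \<open>P i\<close> may be a different one for each relation. In particular \<open>P i\<close> is
  nonempty for \<open>i < d\<close>.\<close>

definition leading :: "(nat \<Rightarrow> nat \<Rightarrow> bool) \<Rightarrow> nat \<Rightarrow> (nat \<Rightarrow> nat set) \<Rightarrow> bool" where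
  "leading R d P \<longleftrightarrow> (\<forall>i<d. \<exists>a\<in>P i. \<forall>j. i < j \<longrightarrow> j < d \<longrightarrow> (\<forall>b\<in>P j. R a b))"

lemma leading_Suc:
  assumes "leading R d P" "a \<in> A" "\<And>i b. i < d \<Longrightarrow> b \<in> P i \<Longrightarrow> R a b"
  shows "leading R (Suc d) (case_nat A P)"
  unfolding leading_def
proof (intro allI impI)
  fix i assume i: "i < Suc d"
  show "\<exists>a\<in>case_nat A P i. \<forall>j. i < j \<longrightarrow> j < Suc d \<longrightarrow> (\<forall>b\<in>case_nat A P j. R a b)"
  proof (cases i)
    case 0
    then show ?thesis using assms(2,3) by (auto split: nat.split intro!: bexI[of _ a])
  next
    case (Suc k)
    then obtain a' where "a' \<in> P k" "\<And>j. k < j \<Longrightarrow> j < d \<Longrightarrow> \<forall>b\<in>P j. R a' b"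
      using assms(1) i unfolding leading_def by auto
    then show ?thesis using Suc by (auto split: nat.split intro!: bexI[of _ a'])
  qed
qed

definition blocks :: "nat set \<Rightarrow> nat \<Rightarrow> (nat \<Rightarrow> nat set) \<Rightarrow> bool" where
  "blocks T d P \<longleftrightarrow> (\<forall>i<d. P i \<subseteq> T) \<and> (\<forall>i<d. \<forall>j<d. i \<noteq> j \<longrightarrow> P i \<inter> P j = {}) \<and> leading (<) d P"

text \<open>The first block consists of the leftmost element, which leads for \<open><\<close>, and
  of an element that leads for \<open>R\<close>. Removing both costs at most two elements (they may
  coincide). The hypothesis speaks of all nonempty subsets so that it survives the removal.\<close>

lemma nested_blocks:
  fixes T :: "nat set"
  assumes "finite T" "2 * d \<le> card T"
    and "\<And>S. S \<subseteq> T \<Longrightarrow> S \<noteq> {} \<Longrightarrow> \<exists>a\<in>S. \<forall>b\<in>S - {a}. R a b"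
  shows "\<exists>P. blocks T d P \<and> leading R d P"
  using assms
proof (induction d arbitrary: T)
  case 0
  then show ?case by (simp add: blocks_def leading_def)
next
  case (Suc d)
  then have "T \<noteq> {}" by auto
  then obtain m where m: "m \<in> T" "\<forall>b\<in>T - {m}. R m b" using Suc.prems(3)[of T] by blast
  let ?l = "Min T"
  have l: "?l \<in> T" "\<forall>b\<in>T - {?l}. ?l < b"
    using \<open>T \<noteq> {}\<close> \<open>finite T\<close> by (auto simp: order_less_le)
  let ?T = "T - {?l, m}"
  have "2 * d \<le> card ?T"
  proof -
    have "card T - card {?l, m} \<le> card ?T" by (rule diff_card_le_card_Diff) simp
    moreover have "card {?l, m} \<le> 2" by (simp add: card_insert_if)
    ultimately show ?thesis using Suc.prems(2) by simp
  qed
  moreover have "finite ?T" using Suc.prems(1) by simp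
  moreover have "\<exists>a\<in>S. \<forall>b\<in>S - {a}. R a b" if "S \<subseteq> ?T" "S \<noteq> {}" for S
    using that by (intro Suc.prems(3)) auto
  ultimately obtain P where P: "blocks ?T d P" "leading R d P"
    using Suc.IH[of ?T] by auto
  have sub: "b \<in> T - {?l, m}" if "i < d" "b \<in> P i" for i b
    using P(1) that by (auto simp: blocks_def)
  let ?P = "case_nat {?l, m} P"
  have "leading (<) (Suc d) ?P"
    using P(1) l sub by (intro leading_Suc[of _ _ _ ?l]) (auto simp: blocks_def)
  moreover have "leading R (Suc d) ?P"
    using P(2) m sub by (intro leading_Suc[of _ _ _ m]) auto
  moreover have "\<forall>i<Suc d. ?P i \<subseteq> T"
    using sub l m by (auto split: nat.split)
  moreover have "?P i \<inter> ?P j = {}" if "i < Suc d" "j < Suc d" "i \<noteq> j" for i j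
    using that P(1) sub by (cases i; cases j) (auto simp: blocks_def)
  ultimately show ?case unfolding blocks_def by (intro exI[of _ ?P]) simp
qed

text \<open>\<open>Q U D\<close> is meant to say that raising the coordinates in \<open>U\<close> and lowering those in \<open>D\<close>
  leads to a larger element.\<close>

locale move_order =
  fixes t :: nat and Q :: "nat set \<Rightarrow> nat set \<Rightarrow> bool"
  assumes asym: "\<And>U D. \<lbrakk>U \<subseteq> {..<t}; D \<subseteq> {..<t}; U \<inter> D = {}; Q U D\<rbrakk> \<Longrightarrow> \<not> Q D U"
    and total: "\<And>U D. \<lbrakk>U \<subseteq> {..<t}; D \<subseteq> {..<t}; U \<inter> D = {}; U \<union> D \<noteq> {}\<rbrakk> \<Longrightarrow> Q U D \<or> Q D U"
    and compose: "\<And>U D U' D'. \<lbrakk>U \<subseteq> {..<t}; D \<subseteq> {..<t}; U \<inter> D = {}; Q U D;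
        U' \<subseteq> {..<t}; D' \<subseteq> {..<t}; U' \<inter> D' = {}; Q U' D'\<rbrakk>
      \<Longrightarrow> Q ((U \<union> U') - (D \<union> D')) ((D \<union> D') - (U \<union> U'))"
begin

text \<open>Reversing the order exchanges raising and lowering. This covers the case in which
  raising single cells mostly leads to smaller elements.\<close>

lemma converse: "move_order t (\<lambda>U D. Q D U)"
proof
  show "Q ((D \<union> D') - (U \<union> U')) ((U \<union> U') - (D \<union> D'))"
    if "U \<subseteq> {..<t}" "D \<subseteq> {..<t}" "U \<inter> D = {}" "Q D U"
      "U' \<subseteq> {..<t}" "D' \<subseteq> {..<t}" "U' \<inter> D' = {}" "Q D' U'" for U D U' D'
    using compose[of D U D' U'] that by (simp add: Int_commute)
qed (use asym total in \<open>blast+\<close>)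

lemma union:
  assumes "U \<union> U' \<union> D \<union> D' \<subseteq> {..<t}" "(U \<union> U') \<inter> (D \<union> D') = {}" "Q U D" "Q U' D'"
  shows "Q (U \<union> U') (D \<union> D')"
proof -
  have "(U \<union> U') - (D \<union> D') = U \<union> U'" "(D \<union> D') - (U \<union> U') = D \<union> D'" using assms by blast+
  moreover have "U \<inter> D = {}" "U' \<inter> D' = {}" using assms by blast+
  ultimately show ?thesis using compose[of U D U' D'] assms by simp
qed

text \<open>\<open>Q\<close> sees only which coordinates move, not how far, so raising
  \<open>a\<close> repeatedly counts as raising it once. Composing the moves
  \<open>Q {a} {b}\<close> thus lets \<open>a\<close> alone outweigh all of \<open>D\<close>, and by
  \<open>up\<close> the rest of \<open>U\<close> only helps.\<close>

lemma dominant: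
  assumes sub: "U \<subseteq> {..<t}" "D \<subseteq> {..<t}" and disj: "U \<inter> D = {}" and "a \<in> U"
    and up: "\<And>k. k \<in> U \<Longrightarrow> Q {k} {}" and dom: "\<And>b. b \<in> D \<Longrightarrow> Q {a} {b}"
  shows "Q U D"
proof -
  have "Q {a} F" if "finite F" "F \<subseteq> D" for F
    using that
  proof (induction F)
    case empty
    then show ?case using up \<open>a \<in> U\<close> by simp
  next
    case (insert b F)
    have "Q ({a} \<union> {a}) ({b} \<union> F)"
      by (rule union) (use insert sub disj \<open>a \<in> U\<close> dom in auto)
    then show ?case by simp
  qed
  then have aD: "Q {a} D" using finite_subset[OF sub(2)] by simp
  have "Q (insert a F) D" if "finite F" "F \<subseteq> U" for F
    using that
  proof (induction F)
    case empty
    then show ?case using aD by simp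
  next
    case (insert k F)
    have "Q ({k} \<union> insert a F) ({} \<union> D)"
      by (rule union) (use insert sub disj \<open>a \<in> U\<close> up in auto)
    then show ?case by (simp add: insert_commute)
  qed
  then show ?thesis using finite_subset[OF sub(1)] \<open>a \<in> U\<close> by (metis finite_lessThan insert_absorb subset_refl)
qed

text \<open>Read \<open>Q {a} {b}\<close> as: cell \<open>a\<close> is more significant than cell
  \<open>b\<close>. On distinct cells this relation is total and transitive, so a finite nonempty
  set has a most significant cell.\<close>

lemma ex_dominant:
  assumes "finite S" "S \<noteq> {}" "S \<subseteq> {..<t}"
  shows "\<exists>a\<in>S. \<forall>b\<in>S - {a}. Q {a} {b}"
  using assms
proof (induction S rule: finite_ne_induct)
  case (singleton x)
  then show ?case by simp
next
  case (insert x S)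
  then obtain a where a: "a \<in> S" "\<forall>b\<in>S - {a}. Q {a} {b}" by auto
  have neq: "x \<noteq> a" using a insert by auto
  then consider "Q {a} {x}" | "Q {x} {a}" using total[of "{a}" "{x}"] a insert by auto
  then show ?case
  proof cases
    case 1
    then show ?thesis using a by auto
  next
    case 2
    have "Q {x} {b}" if b: "b \<in> S" "b \<noteq> a" for b
    proof -
      \<comment> \<open>Transitivity through \<open>a\<close>: it is lowered by one move and raised
        by the other, so it cancels in the composition.\<close>
      have "({x} \<union> {a}) - ({a} \<union> {b}) = {x}" "({a} \<union> {b}) - ({x} \<union> {a}) = {b}"
        using b neq insert by auto
      moreover have "Q (({x} \<union> {a}) - ({a} \<union> {b})) (({a} \<union> {b}) - ({x} \<union> {a}))"
        by (rule compose) (use 2 a b neq insert in auto)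
      ultimately show ?thesis by (simp only:)
    qed
    then show ?thesis using 2 by auto
  qed
qed

end

definition lex_below :: "nat set \<Rightarrow> nat set \<Rightarrow> bool" where
  "lex_below I J \<longleftrightarrow> (\<exists>i\<in>J - I. I \<inter> {..<i} = J \<inter> {..<i})"

text \<open>Let \<open>i\<close> be the least index at which \<open>I\<close> and \<open>J\<close>
  differ. The most significant leader \<open>a\<close> of \<open>P i\<close> is raised, and every
  lowered cell belongs to a block with index beyond \<open>i\<close>, hence is outweighed by
  \<open>a\<close>. All blocks consist of cells whose raising is a gain, so \<open>dominant\<close>
  applies.\<close>

lemma (in move_order) lexicographic_blocks_up:
  assumes "2 * d \<le> card {k. k < t \<and> Q {k} {}}"
  shows "\<exists>P. blocks {..<t} d P \<and>
           (\<forall>I J. I \<subseteq> {..<d} \<longrightarrow> J \<subseteq> {..<d} \<longrightarrow> lex_below I J \<longrightarrow>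
              Q (\<Union>(P ` J) - \<Union>(P ` I)) (\<Union>(P ` I) - \<Union>(P ` J)))"
proof -
  let ?T = "{k. k < t \<and> Q {k} {}}"
  have "\<exists>a\<in>S. \<forall>b\<in>S - {a}. Q {a} {b}" if "S \<subseteq> ?T" "S \<noteq> {}" for S
    using that finite_subset[of S ?T] by (intro ex_dominant) auto
  from nested_blocks[of ?T d "\<lambda>a b. Q {a} {b}", OF _ assms this]
  obtain P where P: "blocks ?T d P" "leading (\<lambda>a b. Q {a} {b}) d P"
    by auto
  have "Q (\<Union>(P ` J) - \<Union>(P ` I)) (\<Union>(P ` I) - \<Union>(P ` J))"
    if IJ: "I \<subseteq> {..<d}" "J \<subseteq> {..<d}" "lex_below I J" for I J
  proof -
    obtain i where i: "i \<in> J" "i \<notin> I" "I \<inter> {..<i} = J \<inter> {..<i}"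
      using IJ(3) by (auto simp: lex_below_def)
    then have "i < d" using IJ by auto
    then obtain a where a: "a \<in> P i" "\<And>j. i < j \<Longrightarrow> j < d \<Longrightarrow> \<forall>b\<in>P j. Q {a} {b}"
      using P(2) unfolding leading_def by auto
    have disj: "P i \<inter> P k = {}" if "k < d" "i \<noteq> k" for k
      using P(1) \<open>i < d\<close> that by (auto simp: blocks_def)
    have sub: "P k \<subseteq> ?T" if "k < d" for k
      using P(1) that by (simp add: blocks_def)
    show ?thesis
    proof (rule dominant)
      show "a \<in> \<Union>(P ` J) - \<Union>(P ` I)"
        using a(1) i disj IJ(1) by blast
      show "Q {a} {b}" if b: "b \<in> \<Union>(P ` I) - \<Union>(P ` J)" for b
      proof -
        obtain j where j: "j \<in> I" "b \<in> P j" using b by blast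
        then have "j \<notin> J" using b by blast
        with i j have "i < j" by (metis Int_iff lessThan_iff nat_neq_iff)
        then show ?thesis using a(2) j IJ(1) by auto
      qed
    qed (use sub IJ in blast)+
  qed
  moreover have "blocks {..<t} d P" using P(1) by (auto simp: blocks_def)
  ultimately show ?thesis by (intro exI[of _ P]) simp
qed

text \<open>By totality, raising a single cell is a gain or a loss, so one of the two happens on at
  least \<open>2 * d\<close> of the \<open>4 * d\<close> cells. Losses are gains for the converse
  order.\<close>

lemma (in move_order) lexicographic_blocks:
  assumes t: "t = 4 * d"
  shows "\<exists>P. blocks {..<t} d P \<and>
           ((\<forall>I J. I \<subseteq> {..<d} \<longrightarrow> J \<subseteq> {..<d} \<longrightarrow> lex_below I J \<longrightarrow>
               Q (\<Union>(P ` J) - \<Union>(P ` I)) (\<Union>(P ` I) - \<Union>(P ` J))) \<or>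
            (\<forall>I J. I \<subseteq> {..<d} \<longrightarrow> J \<subseteq> {..<d} \<longrightarrow> lex_below I J \<longrightarrow>
               Q (\<Union>(P ` I) - \<Union>(P ` J)) (\<Union>(P ` J) - \<Union>(P ` I))))"
proof -
  interpret conv: move_order t "\<lambda>U D. Q D U" by (rule converse)
  have "{..<t} = {k. k < t \<and> Q {k} {}} \<union> {k. k < t \<and> Q {} {k}}"
  proof (rule set_eqI)
    fix k
    show "k \<in> {..<t} \<longleftrightarrow> k \<in> {k. k < t \<and> Q {k} {}} \<union> {k. k < t \<and> Q {} {k}}"
      using total[of "{k}" "{}"] by auto
  qed
  then have "t \<le> card {k. k < t \<and> Q {k} {}} + card {k. k < t \<and> Q {} {k}}"
    by (metis card_Un_le card_lessThan)
  then consider "2 * d \<le> card {k. k < t \<and> Q {k} {}}" | "2 * d \<le> card {k. k < t \<and> Q {} {k}}"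
    using t by linarith
  then show ?thesis
  proof cases
    case 1
    from lexicographic_blocks_up[OF this] show ?thesis by blast
  next
    case 2
    from conv.lexicographic_blocks_up[OF this] show ?thesis by blast
  qed
qed


section \<open>From sets to words\<close>

lemma lex_below_total:
  assumes "I \<noteq> J"
  shows "lex_below I J \<or> lex_below J I"
proof -
  define i where "i = (LEAST i. (i \<in> I) \<noteq> (i \<in> J))"
  have "\<exists>i. (i \<in> I) \<noteq> (i \<in> J)" using assms by blast
  then have i: "(i \<in> I) \<noteq> (i \<in> J)" unfolding i_def by (rule LeastI_ex)
  have "(j \<in> I) = (j \<in> J)" if "j < i" for j
    using not_less_Least[OF that[unfolded i_def]] by simp
  then have "I \<inter> {..<i} = J \<inter> {..<i}" by auto
  then show ?thesis using i unfolding lex_below_def by (cases "i \<in> I") auto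
qed

text \<open>Every abstract move is realised by a pair of concrete vectors, so the axioms are
  inherited from irreflexivity, transitivity and totality of \<open>r\<close>.\<close>

lemma move_order_tails:
  assumes r: "linear_ordering (Pow {..<n}) r"
    and g: "strict_mono_on {..<5 * t} g" "g ` {..<5 * t} \<subseteq> {..<n}"
    and Q: "\<And>c c'. (\<And>k. c k \<le> 2) \<Longrightarrow> (\<And>k. c' k \<le> 2) \<Longrightarrow>
      (tails t g c, tails t g c') \<in> r \<longleftrightarrow> Q {k. k < t \<and> c' k < c k} {k. k < t \<and> c k < c' k}"
  shows "move_order t Q"
proof -
  have r': "trans r" "irrefl r" "total_on (Pow {..<n}) r"
    using r by (auto simp: linear_ordering_def strict_linear_order_on_def)
  \<comment> \<open>Passing from the vector \<open>ind U\<close> to \<open>ind D\<close> lengthens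
    exactly the intervals of the cells in \<open>U\<close> and shortens exactly those in
    \<open>D\<close>.\<close>
  define ind where "ind X k = (if k \<in> X then 1 else 0 :: nat)" for X :: "nat set" and k
  have Q_ind: "(tails t g (ind U), tails t g (ind D)) \<in> r \<longleftrightarrow> Q U D"
    if "U \<subseteq> {..<t}" "D \<subseteq> {..<t}" "U \<inter> D = {}" for U D
  proof -
    have "{k. k < t \<and> ind D k < ind U k} = U" "{k. k < t \<and> ind U k < ind D k} = D"
      using that by (auto simp: ind_def)
    then show ?thesis using Q[of "ind U" "ind D"] by (simp add: ind_def)
  qed
  show ?thesis
  proof
    fix U D :: "nat set"
    assume UD: "U \<subseteq> {..<t}" "D \<subseteq> {..<t}" "U \<inter> D = {}"
    then have DU: "D \<inter> U = {}" by auto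
    show "\<not> Q D U" if "Q U D"
      using that Q_ind[OF UD] Q_ind[OF UD(2,1) DU] r'(1,2) by (metis irrefl_def transD)
    show "Q U D \<or> Q D U" if ne: "U \<union> D \<noteq> {}"
    proof -
      have "tails t g (ind U) \<noteq> tails t g (ind D)"
      proof (cases "U = {}")
        case True
        then obtain k where "k \<in> D" using ne by auto
        then show ?thesis
          using UD by (intro tails_neq[OF g(1), of k]) (auto simp: ind_def)
      next
        case False
        then obtain k where "k \<in> U" by auto
        then have "tails t g (ind D) \<noteq> tails t g (ind U)"
          using UD by (intro tails_neq[OF g(1), of k]) (auto simp: ind_def)
        then show ?thesis by simp
      qed
      then have "(tails t g (ind U), tails t g (ind D)) \<in> r \<or> (tails t g (ind D), tails t g (ind U)) \<in> r"
        using r'(3) tails_subset[OF g(2)] by (auto simp: total_on_def)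
      then show ?thesis using Q_ind[OF UD] Q_ind[OF UD(2,1) DU] by simp
    qed
    fix U' D' :: "nat set"
    assume UD': "U' \<subseteq> {..<t}" "D' \<subseteq> {..<t}" "U' \<inter> D' = {}" and QQ: "Q U D" "Q U' D'"
    \<comment> \<open>The move from \<open>?c\<close> to \<open>?c'\<close> is \<open>U\<close>,
      \<open>D\<close> and the one from \<open>?c'\<close> to \<open>?c''\<close> is
      \<open>U'\<close>, \<open>D'\<close>. The sums reach 2, which is why each cell needs three
      starting points. A coordinate moved once up and once down has equal entries in
      \<open>?c\<close> and \<open>?c''\<close>.\<close>
    let ?c = "\<lambda>k. ind U k + ind U' k"
    let ?c' = "\<lambda>k. ind D k + ind U' k"
    let ?c'' = "\<lambda>k. ind D k + ind D' k"
    have "{k. k < t \<and> ?c' k < ?c k} = U" "{k. k < t \<and> ?c k < ?c' k} = D"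
      using UD by (auto simp: ind_def split: if_splits)
    then have 1: "(tails t g ?c, tails t g ?c') \<in> r"
      using Q[of ?c ?c'] QQ(1) by (simp add: ind_def)
    have "{k. k < t \<and> ?c'' k < ?c' k} = U'" "{k. k < t \<and> ?c' k < ?c'' k} = D'"
      using UD' by (auto simp: ind_def split: if_splits)
    then have 2: "(tails t g ?c', tails t g ?c'') \<in> r"
      using Q[of ?c' ?c''] QQ(2) by (simp add: ind_def)
    have "{k. k < t \<and> ?c'' k < ?c k} = (U \<union> U') - (D \<union> D')"
      "{k. k < t \<and> ?c k < ?c'' k} = (D \<union> D') - (U \<union> U')"
      using UD UD' by (auto simp: ind_def split: if_splits)
    moreover have "(tails t g ?c, tails t g ?c'') \<in> r" using r'(1) 1 2 by (rule transD)
    ultimately show "Q ((U \<union> U') - (D \<union> D')) ((D \<union> D') - (U \<union> U'))"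
      using Q[of ?c ?c''] by (simp add: ind_def)
  qed
qed

section \<open>Sets as words, and the lexicographic order in terms of sets\<close>

definition word_of :: "nat \<Rightarrow> nat set \<Rightarrow> nat list" where
  "word_of n X = map (\<lambda>q. if q \<in> X then 2 else 1) [0..<n]"

lemma word_of_in_words: "word_of n X \<in> words 2 n"
  by (auto simp: word_of_def words_def)

lemma word_of_inject:
  assumes "X \<subseteq> {..<n}" "Y \<subseteq> {..<n}" "word_of n X = word_of n Y"
  shows "X = Y"
proof -
  have "(q \<in> X) = (q \<in> Y)" if "q < n" for q
    using arg_cong[OF assms(3), of "\<lambda>w. w ! q"] that by (auto simp: word_of_def split: if_splits)
  then show ?thesis using assms(1,2) by blast
qed

lemma lexn_iff_nth:
  "(w, w') \<in> lexn lt d \<longleftrightarrow> length w = d \<and> length w' = d \<and>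
     (\<exists>i<d. (w ! i, w' ! i) \<in> lt \<and> (\<forall>j<i. w ! j = w' ! j))"
proof
  assume "(w, w') \<in> lexn lt d"
  then obtain u x y v v' where len: "length w = d" "length w' = d"
    and eq: "w = u @ x # v" "w' = u @ y # v'" and xy: "(x, y) \<in> lt"
    unfolding lexn_conv by auto
  have "length u < d" "(w ! length u, w' ! length u) \<in> lt" "\<forall>j<length u. w ! j = w' ! j"
    using len xy unfolding eq by (simp_all add: nth_append)
  then show "length w = d \<and> length w' = d \<and>
     (\<exists>i<d. (w ! i, w' ! i) \<in> lt \<and> (\<forall>j<i. w ! j = w' ! j))"
    using len by blast
next
  assume "length w = d \<and> length w' = d \<and>
     (\<exists>i<d. (w ! i, w' ! i) \<in> lt \<and> (\<forall>j<i. w ! j = w' ! j))"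
  then obtain i where len: "length w = d" "length w' = d" "i < d"
    and i: "(w ! i, w' ! i) \<in> lt" "\<And>j. j < i \<Longrightarrow> w ! j = w' ! j"
    by auto
  have "take i w = take i w'" using len i(2) by (intro nth_equalityI) auto
  then have "w = take i w @ w ! i # drop (Suc i) w" "w' = take i w @ w' ! i # drop (Suc i) w'"
    using len id_take_nth_drop[of i w] id_take_nth_drop[of i w'] by simp_all
  then show "(w, w') \<in> lexn lt d" using len i(1) unfolding lexn_conv by blast
qed

definition twos :: "nat list \<Rightarrow> nat set" where
  "twos w = {i. i < length w \<and> w ! i = 2}"

lemma words_2_nth: "w \<in> words 2 d \<Longrightarrow> i < d \<Longrightarrow> w ! i = 1 \<or> w ! i = 2"
proof -
  assume "w \<in> words 2 d" "i < d"
  then have "w ! i \<in> {1..2}" using nth_mem[of i w] unfolding words_def by blast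
  then show ?thesis by auto
qed

lemma lexn_12_iff_lex_below:
  assumes w: "w \<in> words 2 d" and w': "w' \<in> words 2 d"
  shows "(w, w') \<in> lexn {(1, 2)} d \<longleftrightarrow> lex_below (twos w) (twos w')"
proof -
  have len: "length w = d" "length w' = d" using w w' by (auto simp: words_def)
  have agree: "twos w \<inter> {..<i} = twos w' \<inter> {..<i} \<longleftrightarrow> (\<forall>j<i. w ! j = w' ! j)" if "i < d" for i
  proof -
    have "(j \<in> twos w) = (j \<in> twos w') \<longleftrightarrow> w ! j = w' ! j" if "j < i" for j
      using words_2_nth[OF w, of j] words_2_nth[OF w', of j] that \<open>i < d\<close> len
      by (auto simp: twos_def)
    then show ?thesis by auto
  qed
  have "i \<in> twos w' - twos w \<longleftrightarrow> i < d \<and> w ! i = 1 \<and> w' ! i = 2" for i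
    using words_2_nth[OF w, of i] len by (auto simp: twos_def)
  then have "lex_below (twos w) (twos w') \<longleftrightarrow>
      (\<exists>i<d. w ! i = 1 \<and> w' ! i = 2 \<and> (\<forall>j<i. w ! j = w' ! j))"
    unfolding lex_below_def using agree by auto
  then show ?thesis using len by (simp add: lexn_iff_nth)
qed

lemma lexn_21_iff_lex_below:
  assumes "w \<in> words 2 d" "w' \<in> words 2 d"
  shows "(w, w') \<in> lexn {(2, 1)} d \<longleftrightarrow> lex_below (twos w') (twos w)"
proof -
  have "(w, w') \<in> lexn {(2, 1)} d \<longleftrightarrow> (w', w) \<in> lexn {(1, 2)} d"
    unfolding lexn_iff_nth by (auto simp: eq_commute)
  then show ?thesis using lexn_12_iff_lex_below assms by simp
qed


section \<open>Lexicographically ordered cubes of sets\<close>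

text \<open>One implication suffices: distinct index sets are comparable under
  \<open>lex_below\<close>, and the wrong comparison would close a cycle in the irreflexive
  transitive relation \<open>s\<close>.\<close>

lemma lex_below_iff:
  assumes s: "trans s" "irrefl s"
    and F: "\<And>I J. \<lbrakk>I \<subseteq> {..<d}; J \<subseteq> {..<d}; lex_below I J\<rbrakk> \<Longrightarrow> (F I, F J) \<in> s"
    and IJ: "I \<subseteq> {..<d}" "J \<subseteq> {..<d}"
  shows "(F I, F J) \<in> s \<longleftrightarrow> lex_below I J"
proof
  assume FIJ: "(F I, F J) \<in> s"
  have "I \<noteq> J" using FIJ s(2) by (auto simp: irrefl_def)
  moreover have "\<not> lex_below J I"
  proof
    assume "lex_below J I"
    then have "(F I, F I) \<in> s" using transD[OF s(1) FIJ F[OF IJ(2,1)]] by simp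
    then show False using s(2) by (auto simp: irrefl_def)
  qed
  ultimately show "lex_below I J" using lex_below_total by blast
qed (use F IJ in simp)

text \<open>This is the result in terms of sets: \<open>A\<close> will hold the fixed letters 2,
  \<open>B i\<close> the positions of \<open>Star i\<close>, and \<open>I\<close> the indices of the
  stars replaced by 2.\<close>

lemma lexicographic_cube_of_sets:
  "\<exists>n. \<forall>r. linear_ordering (Pow {..<n}) r \<longrightarrow>
     (\<exists>A B. A \<subseteq> {..<n} \<and> (\<forall>i<d. A \<inter> B i = {}) \<and> blocks {..<n} d B \<and>
       ((\<forall>I J. I \<subseteq> {..<d} \<longrightarrow> J \<subseteq> {..<d} \<longrightarrow>
           ((A \<union> \<Union>(B ` I), A \<union> \<Union>(B ` J)) \<in> r \<longleftrightarrow> lex_below I J)) \<or>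
        (\<forall>I J. I \<subseteq> {..<d} \<longrightarrow> J \<subseteq> {..<d} \<longrightarrow>
           ((A \<union> \<Union>(B ` I), A \<union> \<Union>(B ` J)) \<in> r \<longleftrightarrow> lex_below J I))))"
proof -
  define t where "t = 4 * d"
  obtain n where n: "\<forall>r :: (nat set \<times> nat set) set. \<exists>g Q.
      strict_mono_on {..<5 * t} g \<and> g ` {..<5 * t} \<subseteq> {..<n} \<and>
      (\<forall>c c'. (\<forall>k. c k \<le> 2) \<and> (\<forall>k. c' k \<le> 2) \<longrightarrow>
        ((tails t g c, tails t g c') \<in> r \<longleftrightarrow> Q {k. k < t \<and> c' k < c k} {k. k < t \<and> c k < c' k}))"
    using homogeneous_tails ..
  show ?thesis
  proof (intro exI[of _ n] allI impI)
    fix r :: "(nat set \<times> nat set) set"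
    assume r: "linear_ordering (Pow {..<n}) r"
    then have r': "trans r" "irrefl r"
      by (auto simp: linear_ordering_def strict_linear_order_on_def)
    from n[THEN spec, of r] obtain g Q where g: "strict_mono_on {..<5 * t} g" "g ` {..<5 * t} \<subseteq> {..<n}"
      and Q: "\<And>c c'. (\<And>k. c k \<le> 2) \<Longrightarrow> (\<And>k. c' k \<le> 2) \<Longrightarrow>
        (tails t g c, tails t g c') \<in> r \<longleftrightarrow> Q {k. k < t \<and> c' k < c k} {k. k < t \<and> c k < c' k}"
      by auto
    interpret move_order t Q using r g Q by (rule move_order_tails)
    obtain P where P: "blocks {..<t} d P" and Q_lex:
        "(\<forall>I J. I \<subseteq> {..<d} \<longrightarrow> J \<subseteq> {..<d} \<longrightarrow> lex_below I J \<longrightarrow>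
            Q (\<Union>(P ` J) - \<Union>(P ` I)) (\<Union>(P ` I) - \<Union>(P ` J))) \<or>
         (\<forall>I J. I \<subseteq> {..<d} \<longrightarrow> J \<subseteq> {..<d} \<longrightarrow> lex_below I J \<longrightarrow>
            Q (\<Union>(P ` I) - \<Union>(P ` J)) (\<Union>(P ` J) - \<Union>(P ` I)))"
      using lexicographic_blocks[OF t_def] by auto
    have P_sub: "P i \<subseteq> {..<t}" if "i < d" for i using P that by (simp add: blocks_def)
    have P_disj: "P i \<inter> P j = {}" if "i < d" "j < d" "i \<noteq> j" for i j
      using P that by (simp add: blocks_def)
    have mono: "g i \<le> g j" if "i \<le> j" "j < 5 * t" for i j
      using g(1) that unfolding strict_mono_on_def by (cases "i = j") (auto intro: less_imp_le)
    \<comment> \<open>Every cell starts at offset 1 by default. Adding its initial piece moves the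
      start to offset 0, so that the cell grows; \<open>B i\<close> gathers these pieces over the
      cells of \<open>P i\<close>.\<close>
    define A where "A = tails t g (\<lambda>_. 1)"
    define B where "B i = (\<Union>k\<in>P i. {g (5 * k)..<g (5 * k + 1)})" for i
    have cube: "A \<union> \<Union>(B ` I) = tails t g (\<lambda>k. if k \<in> \<Union>(P ` I) then 0 else 1)"
      if I: "I \<subseteq> {..<d}" for I
    proof -
      have split: "{g (5 * k)..<g (5 * k + 4)} = {g (5 * k + 1)..<g (5 * k + 4)} \<union> {g (5 * k)..<g (5 * k + 1)}"
        if "k < t" for k
        using mono[of "5 * k" "5 * k + 1"] mono[of "5 * k + 1" "5 * k + 4"] that by auto
      have "tails t g (\<lambda>k. if k \<in> \<Union>(P ` I) then 0 else 1) =
          (\<Union>k<t. {g (5 * k + 1)..<g (5 * k + 4)} \<union>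
             {q. k \<in> \<Union>(P ` I) \<and> q \<in> {g (5 * k)..<g (5 * k + 1)}})"
        unfolding tails_def by (intro SUP_cong refl) (auto simp: split)
      also have "\<dots> = A \<union> (\<Union>k\<in>\<Union>(P ` I). {g (5 * k)..<g (5 * k + 1)})"
      proof -
        have "\<Union>(P ` I) \<subseteq> {..<t}" using P_sub I by blast
        then show ?thesis unfolding A_def tails_def by blast
      qed
      also have "\<dots> = A \<union> \<Union>(B ` I)" unfolding B_def by blast
      finally show ?thesis ..
    qed
    have cube_Q: "(A \<union> \<Union>(B ` I), A \<union> \<Union>(B ` J)) \<in> r \<longleftrightarrow>
        Q (\<Union>(P ` J) - \<Union>(P ` I)) (\<Union>(P ` I) - \<Union>(P ` J))"
      if IJ: "I \<subseteq> {..<d}" "J \<subseteq> {..<d}" for I J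
    proof -
      let ?c = "\<lambda>I k. if k \<in> \<Union>(P ` I) then 0 else 1 :: nat"
      have "\<Union>(P ` I) \<subseteq> {..<t}" "\<Union>(P ` J) \<subseteq> {..<t}" using P_sub IJ by blast+
      then have "{k. k < t \<and> ?c J k < ?c I k} = \<Union>(P ` J) - \<Union>(P ` I)"
        "{k. k < t \<and> ?c I k < ?c J k} = \<Union>(P ` I) - \<Union>(P ` J)"
        by (auto split: if_splits)
      moreover have "(tails t g (?c I), tails t g (?c J)) \<in> r \<longleftrightarrow>
          Q {k. k < t \<and> ?c J k < ?c I k} {k. k < t \<and> ?c I k < ?c J k}"
        by (rule Q) simp_all
      ultimately show ?thesis unfolding cube[OF IJ(1)] cube[OF IJ(2)] by (simp only:)
    qed
    have AB: "A \<inter> B i = {}" if "i < d" for i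
    proof (rule ccontr)
      assume "A \<inter> B i \<noteq> {}"
      then obtain q k l where q: "l < t" "g (5 * l + 1) \<le> q" "q < g (5 * l + 4)"
          "k \<in> P i" "g (5 * k) \<le> q" "q < g (5 * k + 1)"
        unfolding A_def B_def tails_def by auto
      have "k < t" using P_sub[OF that] q(4) by auto
      then show False
        using q mono[of "5 * l + 4" "5 * k"] mono[of "5 * k + 1" "5 * l + 1"] by (cases "l < k") auto
    qed
    have B_disj: "B i \<inter> B j = {}" if ij: "i < d" "j < d" "i \<noteq> j" for i j
    proof (rule ccontr)
      assume "B i \<inter> B j \<noteq> {}"
      then obtain q k l where q: "k \<in> P i" "g (5 * k) \<le> q" "q < g (5 * k + 1)"
          "l \<in> P j" "g (5 * l) \<le> q" "q < g (5 * l + 1)"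
        unfolding B_def by auto
      have "k < t" "l < t" using P_sub ij q(1,4) by auto
      moreover have "k \<noteq> l" using P_disj[OF ij] q(1,4) by auto
      ultimately show False
        using q mono[of "5 * k + 1" "5 * l"] mono[of "5 * l + 1" "5 * k"] by (cases "k < l") auto
    qed
    have B_sub: "B i \<subseteq> {..<n}" if "i < d" for i
    proof
      fix q assume "q \<in> B i"
      then obtain k where k: "k \<in> P i" "q < g (5 * k + 1)" unfolding B_def by auto
      then have "5 * k + 1 < 5 * t" using P_sub[OF that] by auto
      then have "g (5 * k + 1) < n" using g(2) by auto
      then show "q \<in> {..<n}" using k(2) by simp
    qed
    \<comment> \<open>The leftmost cell \<open>a\<close> of \<open>P i\<close> supplies the leading
      point \<open>g (5 * a)\<close>. It lies in the initial piece because \<open>g\<close> is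
      strictly increasing.\<close>
    have B_lead: "leading (<) d B"
      unfolding leading_def
    proof (intro allI impI)
      fix i assume i: "i < d"
      then obtain a where a: "a \<in> P i" "\<And>j b. i < j \<Longrightarrow> j < d \<Longrightarrow> b \<in> P j \<Longrightarrow> a < b"
        using P unfolding blocks_def leading_def by auto
      have "a < t" using P_sub[OF i] a(1) by auto
      then have step: "g (5 * a) < g (5 * a + 1)"
        using g(1) unfolding strict_mono_on_def by auto
      then have "g (5 * a) \<in> B i" using a(1) unfolding B_def by auto
      moreover have "g (5 * a) < q" if j: "i < j" "j < d" and q: "q \<in> B j" for j q
      proof -
        obtain b where b: "b \<in> P j" "g (5 * b) \<le> q" using q unfolding B_def by auto
        then have "a < b" "b < t" using a(2) j P_sub by auto
        then have "g (5 * a + 1) \<le> g (5 * b)" by (intro mono) auto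
        then show ?thesis using step b(2) by simp
      qed
      ultimately show "\<exists>a\<in>B i. \<forall>j. i < j \<longrightarrow> j < d \<longrightarrow> (\<forall>b\<in>B j. a < b)" by blast
    qed
    let ?F = "\<lambda>I. A \<union> \<Union>(B ` I)"
    have "(\<forall>I J. I \<subseteq> {..<d} \<longrightarrow> J \<subseteq> {..<d} \<longrightarrow> ((?F I, ?F J) \<in> r \<longleftrightarrow> lex_below I J)) \<or>
        (\<forall>I J. I \<subseteq> {..<d} \<longrightarrow> J \<subseteq> {..<d} \<longrightarrow> ((?F I, ?F J) \<in> r \<longleftrightarrow> lex_below J I))"
      using Q_lex
    proof (elim disjE)
      assume Q1: "\<forall>I J. I \<subseteq> {..<d} \<longrightarrow> J \<subseteq> {..<d} \<longrightarrow> lex_below I J \<longrightarrow>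
            Q (\<Union>(P ` J) - \<Union>(P ` I)) (\<Union>(P ` I) - \<Union>(P ` J))"
      have "(?F I, ?F J) \<in> r \<longleftrightarrow> lex_below I J" if "I \<subseteq> {..<d}" "J \<subseteq> {..<d}" for I J
        using r' _ that by (rule lex_below_iff[where F = ?F]) (use Q1 cube_Q in simp)
      then show ?thesis by simp
    next
      assume Q2: "\<forall>I J. I \<subseteq> {..<d} \<longrightarrow> J \<subseteq> {..<d} \<longrightarrow> lex_below I J \<longrightarrow>
            Q (\<Union>(P ` I) - \<Union>(P ` J)) (\<Union>(P ` J) - \<Union>(P ` I))"
      \<comment> \<open>The second alternative is the first one for the converse of
        \<open>r\<close>.\<close>
      have conv: "trans (r\<inverse>)" "irrefl (r\<inverse>)" using r' by (auto simp: irrefl_def)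
      have "(?F J, ?F I) \<in> r\<inverse> \<longleftrightarrow> lex_below J I" if "I \<subseteq> {..<d}" "J \<subseteq> {..<d}" for I J
        using conv _ that(2,1) by (rule lex_below_iff[where F = ?F]) (use Q2 cube_Q in simp)
      then show ?thesis by simp
    qed
    moreover have "A \<subseteq> {..<n}" unfolding A_def by (rule tails_subset[OF g(2)])
    moreover have "blocks {..<n} d B" using B_disj B_sub B_lead by (simp add: blocks_def)
    ultimately show "\<exists>A B. A \<subseteq> {..<n} \<and> (\<forall>i<d. A \<inter> B i = {}) \<and> blocks {..<n} d B \<and>
       ((\<forall>I J. I \<subseteq> {..<d} \<longrightarrow> J \<subseteq> {..<d} \<longrightarrow>
           ((A \<union> \<Union>(B ` I), A \<union> \<Union>(B ` J)) \<in> r \<longleftrightarrow> lex_below I J)) \<or>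
        (\<forall>I J. I \<subseteq> {..<d} \<longrightarrow> J \<subseteq> {..<d} \<longrightarrow>
           ((A \<union> \<Union>(B ` I), A \<union> \<Union>(B ` J)) \<in> r \<longleftrightarrow> lex_below J I)))"
      using AB by (intro exI[of _ A] exI[of _ B] conjI allI impI) simp_all
  qed
qed

section \<open>The canonical parameter word of a cube of sets\<close>

text \<open>When the blocks are disjoint, as below, \<open>SOME\<close> has only one index to choose
  from.\<close>

definition cube_word :: "nat \<Rightarrow> nat \<Rightarrow> nat set \<Rightarrow> (nat \<Rightarrow> nat set) \<Rightarrow> symbol list" where
  "cube_word d n A B = map (\<lambda>q. if q \<in> A then Letter 2
     else if \<exists>i<d. q \<in> B i then Star (SOME i. i < d \<and> q \<in> B i) else Letter 1) [0..<n]"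

context
  fixes d n :: nat and A :: "nat set" and B :: "nat \<Rightarrow> nat set"
  assumes A: "\<forall>i<d. A \<inter> B i = {}"
    and B: "blocks {..<n} d B"
begin

lemma cube_word_nth_block:
  assumes "i < d" "q \<in> B i"
  shows "cube_word d n A B ! q = Star i"
proof -
  have "j = i" if "j < d \<and> q \<in> B j" for j
    using B assms that unfolding blocks_def by (metis disjoint_iff)
  then have "(SOME i. i < d \<and> q \<in> B i) = i" using assms by (intro some_equality) blast+
  moreover have "q < n" using B assms unfolding blocks_def by auto
  moreover have "q \<notin> A" using A assms by auto
  ultimately show ?thesis using assms by (auto simp: cube_word_def)
qed

lemma cube_word_nth_eq_Star:
  assumes "q < n" "cube_word d n A B ! q = Star i"
  shows "i < d \<and> q \<in> B i"
proof -
  have ex: "\<exists>i<d. q \<in> B i" and i: "i = (SOME i. i < d \<and> q \<in> B i)"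
    using assms by (auto simp: cube_word_def split: if_splits)
  show ?thesis unfolding i using ex by (rule someI_ex)
qed

lemma cube_word_length [simp]: "length (cube_word d n A B) = n"
  by (simp add: cube_word_def)

lemma cube_word_param: "param_word 2 d n (cube_word d n A B)"
proof -
  have "x \<in> Letter ` {1..2} \<union> Star ` {..<d}" if x: "x \<in> set (cube_word d n A B)" for x
  proof -
    obtain q where q: "q < n" "x = cube_word d n A B ! q"
      using x by (metis in_set_conv_nth cube_word_length)
    show ?thesis
    proof (cases x)
      case (Letter a)
      then have "a = 1 \<or> a = 2" using q by (auto simp: cube_word_def split: if_splits)
      then show ?thesis using Letter by auto
    next
      case (Star i)
      then show ?thesis using q cube_word_nth_eq_Star by auto
    qed
  qed
  moreover have "Star i \<in> set (cube_word d n A B)" if i: "i < d" for i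
  proof -
    obtain q where q: "q \<in> B i" using B i unfolding blocks_def leading_def by auto
    then have "q < n" using B i unfolding blocks_def by auto
    then show ?thesis
      using nth_mem[of q "cube_word d n A B"] cube_word_nth_block[OF i q] by simp
  qed
  ultimately show ?thesis by (auto simp: param_word_def)
qed

text \<open>The leader \<open>a\<close> of \<open>B i\<close> carries \<open>Star i\<close>, so the
  first occurrence of that star is at \<open>a\<close> or earlier. The first occurrence of
  \<open>Star j\<close> lies in \<open>B j\<close>, all of which is beyond \<open>a\<close>.\<close>

lemma cube_word_canonical: "canonical d (cube_word d n A B)"
  unfolding canonical_def
proof (intro allI impI)
  fix i j assume ij: "i < j \<and> j < d"
  let ?p = "cube_word d n A B"
  have lt: "q < n" if "k < d" "q \<in> B k" for k q using B that unfolding blocks_def by auto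
  have lead: "\<exists>a\<in>B i. \<forall>j. i < j \<longrightarrow> j < d \<longrightarrow> (\<forall>b\<in>B j. a < b)" if "i < d" for i
    using B that unfolding blocks_def leading_def by simp
  obtain a where a: "a \<in> B i" "\<And>b. b \<in> B j \<Longrightarrow> a < b"
    using lead[of i] ij by auto
  have "first_occ (Star i) ?p \<le> a"
    unfolding first_occ_def using a(1) ij lt[of i a] cube_word_nth_block[of i a] by (intro Least_le) simp
  moreover have "first_occ (Star j) ?p \<in> B j"
  proof -
    obtain b where "b \<in> B j" using lead[of j] ij by blast
    then have "b < length ?p \<and> ?p ! b = Star j" using ij lt[of j b] cube_word_nth_block[of j b] by simp
    then have "first_occ (Star j) ?p < length ?p \<and> ?p ! first_occ (Star j) ?p = Star j"
      unfolding first_occ_def by (rule LeastI)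
    then show ?thesis using cube_word_nth_eq_Star by simp
  qed
  ultimately show "first_occ (Star i) ?p < first_occ (Star j) ?p" using a(2) by force
qed

text \<open>The letter 2 encodes membership. A position in a block lies in exactly one
  \<open>B i\<close> and outside \<open>A\<close>, so it receives \<open>w ! i\<close>, which is 2
  precisely for \<open>i\<close> in \<open>twos w\<close>.\<close>

lemma subst_cube_word:
  assumes w: "w \<in> words 2 d"
  shows "subst_word (cube_word d n A B) w = word_of n (A \<union> \<Union>(B ` twos w))"
proof (rule nth_equalityI)
  have len: "length w = d" using w by (simp add: words_def)
  fix q assume "q < length (subst_word (cube_word d n A B) w)"
  then have q: "q < n" by (simp add: subst_word_def)
  have "subst_symbol w (cube_word d n A B ! q) = (if q \<in> A \<union> \<Union>(B ` twos w) then 2 else 1)"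
  proof (cases "\<exists>i<d. q \<in> B i")
    case True
    then obtain i where i: "i < d" "q \<in> B i" by auto
    have "j = i" if "j < d" "q \<in> B j" for j
      using B i that unfolding blocks_def by (metis disjoint_iff)
    moreover have "twos w \<subseteq> {..<d}" using len by (auto simp: twos_def)
    ultimately have "q \<in> \<Union>(B ` twos w) \<longleftrightarrow> i \<in> twos w" using i by blast
    moreover have "q \<notin> A" using A i by auto
    ultimately show ?thesis
      using words_2_nth[OF w i(1)] i len cube_word_nth_block[OF i] by (auto simp: twos_def)
  next
    case False
    then show ?thesis using q len by (auto simp: cube_word_def twos_def)
  qed
  then show "subst_word (cube_word d n A B) w ! q = word_of n (A \<union> \<Union>(B ` twos w)) ! q"
    using q by (simp add: subst_word_def word_of_def)
qed (simp add: subst_word_def word_of_def)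

end

theorem theorem3:
  fixes d :: nat
  assumes "d \<ge> 1"
  shows "\<exists>n. \<forall>prec. linear_ordering (words 2 n) prec \<longrightarrow>
           (\<exists>C p lt. is_subcube 2 d n C \<and>
              param_word 2 d n p \<and> canonical d p \<and> C = cube_of 2 d p \<and>
              linear_ordering {1..2} lt \<and>
              restriction 2 d p prec = lex_ordering 2 d lt)"
proof -
  obtain n where n: "\<forall>r. linear_ordering (Pow {..<n}) r \<longrightarrow>
     (\<exists>A B. A \<subseteq> {..<n} \<and> (\<forall>i<d. A \<inter> B i = {}) \<and> blocks {..<n} d B \<and>
       ((\<forall>I J. I \<subseteq> {..<d} \<longrightarrow> J \<subseteq> {..<d} \<longrightarrow>
           ((A \<union> \<Union>(B ` I), A \<union> \<Union>(B ` J)) \<in> r \<longleftrightarrow> lex_below I J)) \<or>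
        (\<forall>I J. I \<subseteq> {..<d} \<longrightarrow> J \<subseteq> {..<d} \<longrightarrow>
           ((A \<union> \<Union>(B ` I), A \<union> \<Union>(B ` J)) \<in> r \<longleftrightarrow> lex_below J I))))"
    using lexicographic_cube_of_sets ..
  show ?thesis
  proof (intro exI[of _ n] allI impI)
    fix prec :: "(nat list \<times> nat list) set"
    assume "linear_ordering (words 2 n) prec"
    then have prec: "trans prec" "irrefl prec" "total_on (words 2 n) prec"
      by (auto simp: linear_ordering_def strict_linear_order_on_def)
    \<comment> \<open>\<open>prec\<close> is pulled back to subsets of \<open>{..<n}\<close>;
      injectivity of \<open>word_of\<close> gives totality.\<close>
    define r where "r = {(X, Y). X \<subseteq> {..<n} \<and> Y \<subseteq> {..<n} \<and> (word_of n X, word_of n Y) \<in> prec}"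
    have "trans r" using prec(1) unfolding r_def trans_def by blast
    moreover have "irrefl r" using prec(2) by (auto simp: r_def irrefl_def)
    moreover have "total_on (Pow {..<n}) r"
    proof (rule total_onI)
      fix X Y assume XY: "X \<in> Pow {..<n}" "Y \<in> Pow {..<n}" "X \<noteq> Y"
      then have "word_of n X \<noteq> word_of n Y" using word_of_inject[of X n Y] by auto
      then have "(word_of n X, word_of n Y) \<in> prec \<or> (word_of n Y, word_of n X) \<in> prec"
        using prec(3) word_of_in_words unfolding total_on_def by simp
      then show "(X, Y) \<in> r \<or> (Y, X) \<in> r" using XY by (auto simp: r_def)
    qed
    ultimately have "linear_ordering (Pow {..<n}) r"
      by (auto simp: linear_ordering_def strict_linear_order_on_def r_def)
    from n[THEN spec, THEN mp, OF this] obtain A B where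
      A: "A \<subseteq> {..<n}" and AB: "\<forall>i<d. A \<inter> B i = {}" "blocks {..<n} d B" and
      lex: "(\<forall>I J. I \<subseteq> {..<d} \<longrightarrow> J \<subseteq> {..<d} \<longrightarrow>
              ((A \<union> \<Union>(B ` I), A \<union> \<Union>(B ` J)) \<in> r \<longleftrightarrow> lex_below I J)) \<or>
            (\<forall>I J. I \<subseteq> {..<d} \<longrightarrow> J \<subseteq> {..<d} \<longrightarrow>
              ((A \<union> \<Union>(B ` I), A \<union> \<Union>(B ` J)) \<in> r \<longleftrightarrow> lex_below J I))"
      by auto
    define p where "p = cube_word d n A B"
    have p: "param_word 2 d n p" "canonical d p"
      using cube_word_param[OF AB] cube_word_canonical[OF AB] by (simp_all only: p_def)
    have twos: "twos w \<subseteq> {..<d}" if "w \<in> words 2 d" for w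
      using that by (auto simp: twos_def words_def)
    have subst: "(subst_word p w, subst_word p w') \<in> prec \<longleftrightarrow>
        (A \<union> \<Union>(B ` twos w), A \<union> \<Union>(B ` twos w')) \<in> r"
      if w: "w \<in> words 2 d" "w' \<in> words 2 d" for w w'
    proof -
      have "A \<union> \<Union>(B ` twos w) \<subseteq> {..<n}" if "w \<in> words 2 d" for w
        using A AB(2) twos[OF that] unfolding blocks_def by auto
      then show ?thesis
        using w unfolding p_def r_def subst_cube_word[OF AB w(1)] subst_cube_word[OF AB w(2)] by simp
    qed
    have "\<exists>lt. linear_ordering {1..2} lt \<and> restriction 2 d p prec = lex_ordering 2 d lt"
      using lex
    \<comment> \<open>The two alternatives correspond to the two orderings of the alphabet: first 1
      before 2, then 2 before 1.\<close>
    proof (elim disjE)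
      assume "\<forall>I J. I \<subseteq> {..<d} \<longrightarrow> J \<subseteq> {..<d} \<longrightarrow>
              ((A \<union> \<Union>(B ` I), A \<union> \<Union>(B ` J)) \<in> r \<longleftrightarrow> lex_below I J)"
      then have "(subst_word p w, subst_word p w') \<in> prec \<longleftrightarrow> (w, w') \<in> lexn {(1, 2)} d"
        if "w \<in> words 2 d" "w' \<in> words 2 d" for w w'
        using that by (simp only: subst twos lexn_12_iff_lex_below)
      then have "restriction 2 d p prec = lex_ordering 2 d {(1, 2)}"
        unfolding restriction_def lex_ordering_def by blast
      moreover have "linear_ordering {1..2} {(1, 2 :: nat)}"
        by (auto simp: linear_ordering_def strict_linear_order_on_def trans_def irrefl_def total_on_def)
      ultimately show ?thesis by blast
    next
      assume "\<forall>I J. I \<subseteq> {..<d} \<longrightarrow> J \<subseteq> {..<d} \<longrightarrow>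
              ((A \<union> \<Union>(B ` I), A \<union> \<Union>(B ` J)) \<in> r \<longleftrightarrow> lex_below J I)"
      then have "(subst_word p w, subst_word p w') \<in> prec \<longleftrightarrow> (w, w') \<in> lexn {(2, 1)} d"
        if "w \<in> words 2 d" "w' \<in> words 2 d" for w w'
        using that by (simp only: subst twos lexn_21_iff_lex_below)
      then have "restriction 2 d p prec = lex_ordering 2 d {(2, 1)}"
        unfolding restriction_def lex_ordering_def by blast
      moreover have "linear_ordering {1..2} {(2, 1 :: nat)}"
        by (auto simp: linear_ordering_def strict_linear_order_on_def trans_def irrefl_def total_on_def)
      ultimately show ?thesis by blast
    qed
    then show "\<exists>C p lt. is_subcube 2 d n C \<and> param_word 2 d n p \<and> canonical d p \<and>
        C = cube_of 2 d p \<and> linear_ordering {1..2} lt \<and>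
        restriction 2 d p prec = lex_ordering 2 d lt"
      using p by (auto simp: is_subcube_def)
  qed
qed

end
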